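(* For every integer $k\ge 3$, let $\hat S_k$ be the signed graph obtained from a negative cycle of length $k$ by adding a set $S$ of $k$ new vertices and $2k$ new edges, so that each edge of the negative cycle is contained in a positive triangle with a distinct vertex of $S$ (each vertex of $S$ is joined exactly to the two ends of its corresponding cycle edge). Then $\hat S_k$ is $C_3^*$-critical and $|E(\hat S_k)|=\frac{3|V(\hat S_k)|}{2}$. In particular there are infinitely many $C_3^*$-critical signed graphs with exactly $\frac32$ times as many edges as vertices.
   Context: All graphs are finite and may have multiple edges or loops. A signed graph $(G,\sigma)$ is a graph $G$ together with a signature $\sigma:E(G)\to\{+,-\}$. A digon is a pair of parallel edges with different signs. A subgraph of a signed graph carries the restricted signature. The sign of a closed walk (in particular of a cycle) is the product of the signs of its edges (with repetition). Switching at a vertex $v$ multiplies the signs of all non-loop edges incident to $v$ by $-$; signed graphs on the same underlying graph whose cycles have the same signs are switching equivalent, so $\hat S_k$ is determined up to switching by the given cycle signs. A homomorphism of $(G,\sigma)$ to $(H,\pi)$ is a mapping $V(G)\to V(H)$ that preserves adjacency and the signs of all closed walks; write $(G,\sigma)\to(H,\pi)$ if one exists. The existence of a homomorphism is invariant under switching. $C_3^*$ is the signed graph on three vertices consisting of a triangle with all three edges positive, together with a negative loop at each vertex. A signed graph $\hat G$ is $C_3^*$-critical if it has no digon and no positive loop, $\hat G\not\to C_3^*$, and $\hat G'\to C_3^*$ for every proper subgraph $\hat G'$ of $\hat G$. *)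

theory Defs
  imports Complex_Main
begin

text \<open>
  Signed multigraphs. The set of ends of an edge has two elements for an ordinary edge and one
  element for a loop. Signs are the integers \<open>1\<close> and \<open>-1\<close>.
\<close>

record ('v, 'e) sgraph =
  verts :: "'v set"
  edges :: "'e set"
  ends :: "'e \<Rightarrow> 'v set"
  sgn_of :: "'e \<Rightarrow> int"

definition signed_graph :: "('v, 'e) sgraph \<Rightarrow> bool" where
  "signed_graph G \<longleftrightarrow> finite (verts G) \<and> finite (edges G) \<and>
     (\<forall>e\<in>edges G. ends G e \<subseteq> verts G \<and> card (ends G e) \<in> {1, 2} \<and> sgn_of G e \<in> {1, -1})"

definition is_loop :: "('v, 'e) sgraph \<Rightarrow> 'e \<Rightarrow> bool" where
  "is_loop G e \<longleftrightarrow> card (ends G e) = 1"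

text \<open>A walk from \<open>u\<close> to \<open>v\<close>, given by its sequence of edges.\<close>

fun walk :: "('v, 'e) sgraph \<Rightarrow> 'v \<Rightarrow> 'e list \<Rightarrow> 'v \<Rightarrow> bool" where
  "walk G u [] v \<longleftrightarrow> u \<in> verts G \<and> u = v"
| "walk G u (e # es) v \<longleftrightarrow>
     u \<in> verts G \<and> e \<in> edges G \<and> (\<exists>w. ends G e = {u, w} \<and> walk G w es v)"

definition walk_sign :: "('v, 'e) sgraph \<Rightarrow> 'e list \<Rightarrow> int" where
  "walk_sign G es = prod_list (map (sgn_of G) es)"

text \<open>
  A vertex map is a homomorphism if it preserves adjacency and the signs of closed walks. With
  parallel edges the image of a walk depends on which edge each edge is sent to, hence the edge
  map \<open>\<phi>\<close>; it is uniquely determined when the target has no parallel edges, as is the case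
  for \<open>C3_star\<close> below.
\<close>

definition is_hom :: "('v, 'e) sgraph \<Rightarrow> ('w, 'd) sgraph \<Rightarrow> ('v \<Rightarrow> 'w) \<Rightarrow> bool" where
  "is_hom G H f \<longleftrightarrow> f ` verts G \<subseteq> verts H \<and>
     (\<exists>\<phi>. (\<forall>e\<in>edges G. \<phi> e \<in> edges H \<and> ends H (\<phi> e) = f ` ends G e) \<and>
          (\<forall>u es. walk G u es u \<longrightarrow> walk_sign H (map \<phi> es) = walk_sign G es))"

definition hom_to :: "('v, 'e) sgraph \<Rightarrow> ('w, 'd) sgraph \<Rightarrow> bool" where
  "hom_to G H \<longleftrightarrow> (\<exists>f. is_hom G H f)"

definition subgraph :: "('v, 'e) sgraph \<Rightarrow> ('v, 'e) sgraph \<Rightarrow> bool" where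
  "subgraph H G \<longleftrightarrow> signed_graph H \<and> verts H \<subseteq> verts G \<and> edges H \<subseteq> edges G \<and>
     (\<forall>e\<in>edges H. ends H e = ends G e \<and> sgn_of H e = sgn_of G e)"

definition proper_subgraph :: "('v, 'e) sgraph \<Rightarrow> ('v, 'e) sgraph \<Rightarrow> bool" where
  "proper_subgraph H G \<longleftrightarrow> subgraph H G \<and> (verts H \<noteq> verts G \<or> edges H \<noteq> edges G)"

definition has_digon :: "('v, 'e) sgraph \<Rightarrow> bool" where
  "has_digon G \<longleftrightarrow>
     (\<exists>e\<in>edges G. \<exists>e'\<in>edges G. ends G e = ends G e' \<and> sgn_of G e \<noteq> sgn_of G e')"

definition has_positive_loop :: "('v, 'e) sgraph \<Rightarrow> bool" where
  "has_positive_loop G \<longleftrightarrow> (\<exists>e\<in>edges G. is_loop G e \<and> sgn_of G e = 1)"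

text \<open>In this graph every edge is represented by its set of ends.\<close>

definition C3_star :: "(nat, nat set) sgraph" where
  "C3_star = \<lparr> verts = {0, 1, 2},
               edges = {{0, 1}, {1, 2}, {0, 2}, {0}, {1}, {2}},
               ends = (\<lambda>e. e),
               sgn_of = (\<lambda>e. if e \<in> {{0, 1}, {1, 2}, {0, 2}} then 1 else -1) \<rparr>"

definition C3_star_critical :: "('v, 'e) sgraph \<Rightarrow> bool" where
  "C3_star_critical G \<longleftrightarrow>
     signed_graph G \<and> \<not> has_digon G \<and> \<not> has_positive_loop G \<and>
     \<not> hom_to G C3_star \<and> (\<forall>G'. proper_subgraph G' G \<longrightarrow> hom_to G' C3_star)"

text \<open>
  \<open>is_S_hat k G\<close> says that \<open>G\<close> is a copy of the signed graph \<open>S\<^sub>k\<close>, with any signature having the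
  prescribed cycle signs: the \<open>c i\<close> form a negative cycle through the vertices \<open>x i\<close>, and the
  edges \<open>c i\<close>, \<open>b i\<close>, \<open>a i\<close> form a positive triangle with the new vertex \<open>s i\<close>.
\<close>

definition is_S_hat :: "nat \<Rightarrow> ('v, 'e) sgraph \<Rightarrow> bool" where
  "is_S_hat k G \<longleftrightarrow> signed_graph G \<and>
     (\<exists>(x :: nat \<Rightarrow> 'v) (s :: nat \<Rightarrow> 'v) (c :: nat \<Rightarrow> 'e) (a :: nat \<Rightarrow> 'e) (b :: nat \<Rightarrow> 'e).
        inj_on x {..<k} \<and> inj_on s {..<k} \<and> x ` {..<k} \<inter> s ` {..<k} = {} \<and>
        verts G = x ` {..<k} \<union> s ` {..<k} \<and>
        inj_on c {..<k} \<and> inj_on a {..<k} \<and> inj_on b {..<k} \<and>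
        c ` {..<k} \<inter> a ` {..<k} = {} \<and> c ` {..<k} \<inter> b ` {..<k} = {} \<and>
        a ` {..<k} \<inter> b ` {..<k} = {} \<and>
        edges G = c ` {..<k} \<union> a ` {..<k} \<union> b ` {..<k} \<and>
        (\<forall>i<k. ends G (c i) = {x i, x (Suc i mod k)} \<and>
               ends G (a i) = {s i, x i} \<and>
               ends G (b i) = {s i, x (Suc i mod k)}) \<and>
        walk_sign G (map c [0..<k]) = -1 \<and>
        (\<forall>i<k. walk_sign G [c i, b i, a i] = 1))"

text \<open>
  Isomorphism up to switching, used to count signed graphs. Switching at a vertex leaves the signs
  of loops unchanged.
\<close>

definition switch_at :: "'v \<Rightarrow> ('v, 'e) sgraph \<Rightarrow> ('v, 'e) sgraph" where
  "switch_at v G =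
     G\<lparr>sgn_of := (\<lambda>e. if v \<in> ends G e \<and> \<not> is_loop G e then - sgn_of G e else sgn_of G e)\<rparr>"

definition switching_equivalent :: "('v, 'e) sgraph \<Rightarrow> ('v, 'e) sgraph \<Rightarrow> bool" where
  "switching_equivalent = (\<lambda>G H. \<exists>v\<in>verts G. H = switch_at v G)\<^sup>*\<^sup>*"

definition isomorphic :: "('v, 'e) sgraph \<Rightarrow> ('w, 'd) sgraph \<Rightarrow> bool" where
  "isomorphic G H \<longleftrightarrow>
     (\<exists>f \<phi>. bij_betw f (verts G) (verts H) \<and> bij_betw \<phi> (edges G) (edges H) \<and>
            (\<forall>e\<in>edges G. ends H (\<phi> e) = f ` ends G e \<and> sgn_of H (\<phi> e) = sgn_of G e))"

definition switching_isomorphic :: "('v, 'e) sgraph \<Rightarrow> ('w, 'd) sgraph \<Rightarrow> bool" where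
  "switching_isomorphic G H \<longleftrightarrow> (\<exists>G'. switching_equivalent G G' \<and> isomorphic G' H)"

end

theory Submission
  imports Defs
begin

text \<open>
  A vertex map to the three colours is a homomorphism to \<open>C3_star\<close> iff, up to switching, exactly
  the monochromatic edges are negative. A triangle never has exactly two monochromatic edges, so a
  positive triangle has none. In \<open>S\<^sub>k\<close> this makes every edge of the negative cycle bichromatic, a
  contradiction. If an edge of the \<open>j\<close>th triangle is missing, there is room for exactly one
  monochromatic edge on the negative cycle: the cycle edge itself, or, when that edge is the one
  missing, one of the two edges replacing it.
\<close>

section \<open>Colourings with switching as homomorphisms to \<open>C3_star\<close>\<close>

text \<open>The sign of the unique edge of \<open>C3_star\<close> between the colours
  \<open>p\<close> and \<open>q\<close>, a loop when they coincide.\<close>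

definition mono_sign :: "nat \<Rightarrow> nat \<Rightarrow> int" where
  "mono_sign p q = (if p = q then -1 else 1)"

lemma mono_sign_simps [simp]:
  "mono_sign p p = -1" "p \<noteq> q \<Longrightarrow> mono_sign p q = 1"
  by (auto simp: mono_sign_def)

lemma mono_sign_commute: "mono_sign p q = mono_sign q p"
  by (auto simp: mono_sign_def)

lemma verts_C3_star: "verts C3_star = {..<3}"
  by (auto simp: C3_star_def)

lemma ends_C3_star [simp]: "ends C3_star e = e"
  by (simp add: C3_star_def)

lemma edges_C3_star: "p < 3 \<Longrightarrow> q < 3 \<Longrightarrow> {p, q} \<in> edges C3_star"
  by (auto simp: C3_star_def numeral_3_eq_3 less_Suc_eq doubleton_eq_iff)

lemma sgn_of_C3_star: "p < 3 \<Longrightarrow> q < 3 \<Longrightarrow> sgn_of C3_star {p, q} = mono_sign p q"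
  by (auto simp: C3_star_def mono_sign_def numeral_3_eq_3 less_Suc_eq doubleton_eq_iff)

lemma sign_square: "t \<in> {1, -1} \<Longrightarrow> t * t = (1 :: int)"
  by auto

text \<open>Here \<open>t\<close> is a switching function. Along a walk every inner visit to a
  vertex contributes its factor \<open>t\<close> twice, so the sign of the walk and that of its
  image differ by \<open>t u * t v\<close>, which is 1 when the walk is closed.\<close>

lemma hom_to_C3_starI:
  fixes f :: "'v \<Rightarrow> nat" and t :: "'v \<Rightarrow> int"
  assumes f: "\<And>v. v \<in> verts H \<Longrightarrow> f v < 3"
    and t: "\<And>v. v \<in> verts H \<Longrightarrow> t v \<in> {1, -1}"
    and edge: "\<And>e. e \<in> edges H \<Longrightarrow> \<exists>u\<in>verts H. \<exists>v\<in>verts H. ends H e = {u, v} \<and>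
       sgn_of H e = t u * t v * mono_sign (f u) (f v)"
  shows "hom_to H C3_star"
proof -
  let ?\<phi> = "\<lambda>e. f ` ends H e"
  have sign: "walk_sign H es = t u * t v * walk_sign C3_star (map ?\<phi> es)"
    if "walk H u es v" for u es v
    using that
  proof (induction es arbitrary: u)
    case Nil
    then have "v \<in> verts H" "u = v" by auto
    then show ?case using sign_square[OF t] by (simp add: walk_sign_def)
  next
    case (Cons e es)
    then obtain w where e: "e \<in> edges H" "ends H e = {u, w}" and w: "walk H w es v"
      by auto
    obtain u' v' where uv: "u' \<in> verts H" "v' \<in> verts H" "ends H e = {u', v'}"
      "sgn_of H e = t u' * t v' * mono_sign (f u') (f v')"
      using edge[OF e(1)] by blast
    have "u' = u \<and> v' = w \<or> u' = w \<and> v' = u"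
      using e(2) uv(3) by (auto simp: doubleton_eq_iff)
    then have sg: "sgn_of H e = t u * t w * mono_sign (f u) (f w)" and wV: "w \<in> verts H" "u \<in> verts H"
      using uv by (auto simp: mono_sign_commute)
    have "sgn_of C3_star (?\<phi> e) = mono_sign (f u) (f w)"
      using e(2) wV f sgn_of_C3_star by simp
    then show ?case
      using Cons.IH[OF w] sg sign_square[OF t[OF wV(1)]]
      by (simp add: walk_sign_def algebra_simps)
  qed
  have "is_hom H C3_star f"
    unfolding is_hom_def
  proof (intro conjI exI[of _ ?\<phi>] ballI allI impI)
    show "f ` verts H \<subseteq> verts C3_star"
      using f by (auto simp: verts_C3_star)
  next
    fix e assume "e \<in> edges H"
    then show "?\<phi> e \<in> edges C3_star"
      using edge[of e] f edges_C3_star by fastforce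
  next
    fix u es assume w: "walk H u es u"
    then have "u \<in> verts H" by (cases es) auto
    then show "walk_sign C3_star (map ?\<phi> es) = walk_sign H es"
      using sign[OF w] sign_square[OF t] by simp
  qed simp
  then show ?thesis by (auto simp: hom_to_def)
qed

lemma walk_append_edge:
  assumes "walk G u es v" "e \<in> edges G" "ends G e = {v, w}" "w \<in> verts G"
  shows "walk G u (es @ [e]) w"
  using assms by (induction es arbitrary: u) auto

section \<open>Labelled copies of the graph and their basic properties\<close>

locale S_hat =
  fixes k :: nat and G :: "('v, 'e) sgraph"
    and x s :: "nat \<Rightarrow> 'v" and c a b :: "nat \<Rightarrow> 'e"
  assumes k: "k \<ge> 3"
    and G: "signed_graph G"
    and inj_x: "inj_on x {..<k}" and inj_s: "inj_on s {..<k}"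
    and x_s: "x ` {..<k} \<inter> s ` {..<k} = {}"
    and verts_eq: "verts G = x ` {..<k} \<union> s ` {..<k}"
    and inj_c: "inj_on c {..<k}" and inj_a: "inj_on a {..<k}" and inj_b: "inj_on b {..<k}"
    and c_a: "c ` {..<k} \<inter> a ` {..<k} = {}"
    and c_b: "c ` {..<k} \<inter> b ` {..<k} = {}"
    and a_b: "a ` {..<k} \<inter> b ` {..<k} = {}"
    and edges_eq: "edges G = c ` {..<k} \<union> a ` {..<k} \<union> b ` {..<k}"
    and ends_c: "i < k \<Longrightarrow> ends G (c i) = {x i, x (Suc i mod k)}"
    and ends_a: "i < k \<Longrightarrow> ends G (a i) = {s i, x i}"
    and ends_b: "i < k \<Longrightarrow> ends G (b i) = {s i, x (Suc i mod k)}"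
    and cycle_sign: "(\<Prod>i<k. sgn_of G (c i)) = -1"
    and triangle_sign: "i < k \<Longrightarrow> sgn_of G (c i) * sgn_of G (b i) * sgn_of G (a i) = 1"

lemma walk_sign_map_upt: "walk_sign G (map c [0..<k]) = (\<Prod>i<k. sgn_of G (c i))"
  by (induction k) (simp_all add: walk_sign_def mult.commute)

lemma is_S_hat_iff:
  assumes "k \<ge> 3"
  shows "is_S_hat k G \<longleftrightarrow> (\<exists>x s c a b. S_hat k G x s c a b)"
  using assms unfolding is_S_hat_def S_hat_def walk_sign_map_upt
  by (simp add: walk_sign_def mult.assoc imp_conjR all_conj_distrib)

context S_hat
begin

lemma edge_mem: "i < k \<Longrightarrow> c i \<in> edges G" "i < k \<Longrightarrow> a i \<in> edges G" "i < k \<Longrightarrow> b i \<in> edges G"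
  by (auto simp: edges_eq)

lemma vert_mem: "i < k \<Longrightarrow> x i \<in> verts G" "i < k \<Longrightarrow> s i \<in> verts G"
  by (auto simp: verts_eq)

lemma Suc_mod: "Suc i mod k < k"
  using k by simp

lemma x_eq_iff: "i < k \<Longrightarrow> j < k \<Longrightarrow> x i = x j \<longleftrightarrow> i = j"
  using inj_x by (auto simp: inj_on_def)

lemma s_eq_iff: "i < k \<Longrightarrow> j < k \<Longrightarrow> s i = s j \<longleftrightarrow> i = j"
  using inj_s by (auto simp: inj_on_def)

lemma x_neq_s: "i < k \<Longrightarrow> j < k \<Longrightarrow> x i \<noteq> s j"
  using x_s by auto

lemma Suc_mod_neq: "i < k \<Longrightarrow> Suc i mod k \<noteq> i"
  using k by (auto simp: mod_Suc)

lemma Suc_mod_swap: "i < k \<Longrightarrow> j < k \<Longrightarrow> i = Suc j mod k \<Longrightarrow> Suc i mod k \<noteq> j"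
  using k by (auto simp: mod_Suc split: if_splits)

lemma edge_cases:
  assumes "e \<in> edges G"
  obtains i where "i < k" "e = c i" | i where "i < k" "e = a i" | i where "i < k" "e = b i"
  using assms by (auto simp: edges_eq)

text \<open>The end \<open>s i\<close> identifies the triangle of an edge \<open>a i\<close> or
  \<open>b i\<close> and separates both from the cycle edges. Two parallel cycle edges would need
  indices that are successors of each other, impossible for \<open>k \<ge> 3\<close>.\<close>

lemma inj_ends: "inj_on (ends G) (edges G)"
proof (rule inj_onI)
  fix e e' assume e: "e \<in> edges G" and e': "e' \<in> edges G" and eq: "ends G e = ends G e'"
  note iffs = ends_c ends_a ends_b doubleton_eq_iff x_eq_iff s_eq_iff x_neq_s
    x_neq_s[symmetric] Suc_mod
  from e show "e = e'"
  proof (cases rule: edge_cases)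
    case (1 i)
    from e' show ?thesis
      by (cases rule: edge_cases) (use 1 eq Suc_mod_swap in \<open>auto simp: iffs\<close>)
  next
    case (2 i)
    from e' show ?thesis
      by (cases rule: edge_cases) (use 2 eq Suc_mod_neq in \<open>auto simp: iffs\<close>)
  next
    case (3 i)
    from e' show ?thesis
      by (cases rule: edge_cases) (use 3 eq Suc_mod_neq in \<open>auto simp: iffs\<close>)
  qed
qed

lemma no_digon: "\<not> has_digon G"
  using inj_ends by (auto simp: has_digon_def inj_on_def)

lemma no_loop: "e \<in> edges G \<Longrightarrow> \<not> is_loop G e"
  by (erule edge_cases)
    (auto simp: is_loop_def ends_c ends_a ends_b x_eq_iff x_neq_s x_neq_s[symmetric] Suc_mod
      Suc_mod_neq Suc_mod_neq[symmetric] card_insert_if)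

lemma card_verts: "card (verts G) = 2 * k"
  by (simp add: verts_eq card_Un_disjoint x_s card_image inj_x inj_s)

lemma card_edges: "card (edges G) = 3 * k"
  by (simp add: edges_eq card_Un_disjoint Int_Un_distrib2 c_a c_b a_b card_image inj_c inj_a inj_b)

lemma sgn_cases: "e \<in> edges G \<Longrightarrow> sgn_of G e \<in> {1, -1}"
  using G by (auto simp: signed_graph_def)

section \<open>Nonexistence of a homomorphism on the whole graph\<close>

lemma walk_triangle:
  assumes i: "i < k"
  shows "walk G (x i) [c i, b i, a i] (x i)"
proof -
  have "ends G (b i) = {x (Suc i mod k), s i}"
    using ends_b[OF i] by (simp add: insert_commute)
  then have "walk G (x (Suc i mod k)) [b i, a i] (x i)"
    using i edge_mem vert_mem Suc_mod ends_a[OF i] by (auto simp: doubleton_eq_iff)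
  then show ?thesis
    unfolding walk.simps(2)[of _ _ "c i"]
    using edge_mem(1)[OF i] vert_mem(1)[OF i] ends_c[OF i] by blast
qed

lemma walk_cycle: "walk G (x 0) (map c [0..<k]) (x 0)"
proof -
  \<comment> \<open>The reduction modulo \<open>k\<close> matters only at \<open>n = k\<close>,
    where the walk returns to \<open>x 0\<close>.\<close>
  have "walk G (x 0) (map c [0..<n]) (x (n mod k))" if "n \<le> k" for n
    using that
  proof (induction n)
    case 0
    then show ?case using k vert_mem by simp
  next
    case (Suc n)
    then show ?case
      using walk_append_edge[of G "x 0" "map c [0..<n]" "x n" "c n" "x (Suc n mod k)"]
        edge_mem vert_mem Suc_mod ends_c by simp
  qed
  from this[of k] show ?thesis by simp
qed

lemma not_hom_to_C3_star: "\<not> hom_to G C3_star"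
proof
  assume "hom_to G C3_star"
  \<comment> \<open>The edge map is forced, since the edges of \<open>C3_star\<close> are their own
    end sets.\<close>
  then obtain f \<phi> where f: "f ` verts G \<subseteq> verts C3_star"
    and \<phi>: "\<And>e. e \<in> edges G \<Longrightarrow> \<phi> e = f ` ends G e"
    and sign: "\<And>u es. walk G u es u \<Longrightarrow> walk_sign C3_star (map \<phi> es) = walk_sign G es"
    unfolding hom_to_def is_hom_def ends_C3_star by metis
  have f3: "f v < 3" if "v \<in> verts G" for v
    using f that by (auto simp: verts_C3_star)
  note image_sign = \<phi> edge_mem ends_c ends_a ends_b sgn_of_C3_star f3 vert_mem Suc_mod
  \<comment> \<open>If the ends of \<open>c i\<close> had equal colours, the images of
    \<open>a i\<close> and \<open>b i\<close> would have the same sign and that of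
    \<open>c i\<close> would be negative, so the positive triangle would have a negative
    image.\<close>
  have neq: "f (x i) \<noteq> f (x (Suc i mod k))" if i: "i < k" for i
    using sign[OF walk_triangle[OF i]] triangle_sign[OF i] i
    by (auto simp: walk_sign_def image_sign mono_sign_def mult.assoc split: if_splits)
  have "walk_sign C3_star (map \<phi> (map c [0..<k])) = (\<Prod>i<k. sgn_of C3_star (\<phi> (c i)))"
    using walk_sign_map_upt[of C3_star "\<lambda>i. \<phi> (c i)" k] by (simp add: comp_def)
  also have "\<dots> = 1"
    by (rule prod.neutral) (auto simp: image_sign neq)
  finally show False
    using sign[OF walk_cycle] walk_sign_map_upt[of G c k] cycle_sign by simp
qed

section \<open>Colouring subgraphs index by index\<close>

definition on_verts :: "(nat \<Rightarrow> 'z) \<Rightarrow> (nat \<Rightarrow> 'z) \<Rightarrow> 'v \<Rightarrow> 'z" where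
  "on_verts g h v = (if v \<in> x ` {..<k} then g (inv_into {..<k} x v) else h (inv_into {..<k} s v))"

lemma on_verts_x: "i < k \<Longrightarrow> on_verts g h (x i) = g i"
  by (simp add: on_verts_def inv_into_f_f[OF inj_x])

lemma on_verts_s: "i < k \<Longrightarrow> on_verts g h (s i) = h i"
  using x_s by (auto simp: on_verts_def inv_into_f_f[OF inj_s])

text \<open>Colours \<open>p\<close> and switches \<open>t\<close> belong to the cycle vertices,
  \<open>q\<close> and \<open>r\<close> to the new ones. Edges missing from \<open>H\<close> impose
  nothing.\<close>

lemma hom_to_C3_star_subgraphI:
  fixes p q :: "nat \<Rightarrow> nat" and t r :: "nat \<Rightarrow> int"
  assumes H: "subgraph H G"
    and p: "\<And>i. i < k \<Longrightarrow> p i < 3" and q: "\<And>i. i < k \<Longrightarrow> q i < 3"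
    and t: "\<And>i. i < k \<Longrightarrow> t i \<in> {1, -1}" and r: "\<And>i. i < k \<Longrightarrow> r i \<in> {1, -1}"
    and c: "\<And>i. i < k \<Longrightarrow> c i \<in> edges H \<Longrightarrow>
      sgn_of G (c i) = t i * t (Suc i mod k) * mono_sign (p i) (p (Suc i mod k))"
    and a: "\<And>i. i < k \<Longrightarrow> a i \<in> edges H \<Longrightarrow>
      sgn_of G (a i) = r i * t i * mono_sign (q i) (p i)"
    and b: "\<And>i. i < k \<Longrightarrow> b i \<in> edges H \<Longrightarrow>
      sgn_of G (b i) = r i * t (Suc i mod k) * mono_sign (q i) (p (Suc i mod k))"
  shows "hom_to H C3_star"
proof (rule hom_to_C3_starI)
  fix v assume "v \<in> verts H"
  then have "v \<in> verts G" using H by (auto simp: subgraph_def)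
  then obtain i where i: "i < k" "v = x i \<or> v = s i" by (auto simp: verts_eq)
  show "on_verts p q v < 3" "on_verts t r v \<in> {1, -1}"
    using i p[of i] q[of i] t[of i] r[of i] by (auto simp: on_verts_x on_verts_s)
next
  fix e assume e: "e \<in> edges H"
  then have eG: "e \<in> edges G" "ends H e = ends G e" "sgn_of H e = sgn_of G e"
    using H by (auto simp: subgraph_def)
  \<comment> \<open>\<open>H\<close> may have lost vertices, but not the ends of an edge it
    keeps.\<close>
  have "ends H e \<subseteq> verts H"
    using H e unfolding subgraph_def signed_graph_def by blast
  let ?P = "\<lambda>u v. ends H e = {u, v} \<and> sgn_of H e =
    on_verts t r u * on_verts t r v * mono_sign (on_verts p q u) (on_verts p q v)"
  have "\<exists>u v. ?P u v"
    using eG(1)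
  proof (cases rule: edge_cases)
    case (1 i)
    then have "?P (x i) (x (Suc i mod k))"
      using e c[of i] eG(2,3) by (simp add: ends_c on_verts_x Suc_mod)
    then show ?thesis by blast
  next
    case (2 i)
    then have "?P (s i) (x i)"
      using e a[of i] eG(2,3) by (simp add: ends_a on_verts_x on_verts_s)
    then show ?thesis by blast
  next
    case (3 i)
    then have "?P (s i) (x (Suc i mod k))"
      using e b[of i] eG(2,3) by (simp add: ends_b on_verts_x on_verts_s Suc_mod)
    then show ?thesis by blast
  qed
  then show "\<exists>u\<in>verts H. \<exists>v\<in>verts H. ?P u v"
    using \<open>ends H e \<subseteq> verts H\<close> by (auto 0 3)
qed

text \<open>The sign of the path from \<open>x 0\<close> to \<open>x i\<close> along the cycle.
  Switching by it makes every cycle edge positive except the closing edge \<open>c (k - 1)\<close>,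
  which becomes negative.\<close>

definition prefix_sign :: "nat \<Rightarrow> int" where
  "prefix_sign i = (\<Prod>j<i. sgn_of G (c j))"

lemma prefix_sign_0: "prefix_sign 0 = 1"
  by (simp add: prefix_sign_def)

lemma prefix_sign_cases: "i \<le> k \<Longrightarrow> prefix_sign i \<in> {1, -1}"
proof (induction i)
  case (Suc i)
  then show ?case using sgn_cases[OF edge_mem(1), of i] by (auto simp: prefix_sign_def)
qed (simp add: prefix_sign_def)

lemma prefix_sign_last: "prefix_sign (k - 1) * sgn_of G (c (k - 1)) = -1"
  using cycle_sign k prod.lessThan_Suc[of "\<lambda>j. sgn_of G (c j)" "k - 1"]
  by (simp add: prefix_sign_def)

text \<open>After switching by \<open>prefix_sign\<close> the path edges are positive and need ends
  of distinct colours. In every triangle but the last, the new vertex takes the third colour and the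
  switch that suits \<open>a i\<close>; positivity then settles \<open>b i\<close>. The closing
  edge, now negative, must be monochromatic if it is present.\<close>

lemma hom_to_C3_star_last_triangleI:
  fixes p :: "nat \<Rightarrow> nat" and q :: nat and r :: int
  assumes H: "subgraph H G"
    and p: "\<And>i. i < k \<Longrightarrow> p i < 3" and p_Suc: "\<And>i. Suc i < k \<Longrightarrow> p i \<noteq> p (Suc i)"
    and q: "q < 3" and r: "r \<in> {1, -1}"
    and c: "c (k - 1) \<in> edges H \<Longrightarrow> p (k - 1) = p 0"
    and a: "a (k - 1) \<in> edges H \<Longrightarrow>
      sgn_of G (a (k - 1)) = r * prefix_sign (k - 1) * mono_sign q (p (k - 1))"
    and b: "b (k - 1) \<in> edges H \<Longrightarrow> sgn_of G (b (k - 1)) = r * mono_sign q (p 0)"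
  shows "hom_to H C3_star"
proof (rule hom_to_C3_star_subgraphI[where t = prefix_sign and p = p
      and q = "\<lambda>i. if i = k - 1 then q else 3 - p i - p (Suc i)"
      and r = "\<lambda>i. if i = k - 1 then r else prefix_sign i * sgn_of G (a i)"])
  have last: "Suc (k - 1) mod k = 0" using k by simp
  \<comment> \<open>The colours 0, 1, 2 sum to 3, so subtracting two distinct ones leaves the third,
    without truncation.\<close>
  have third: "3 - p i - p (Suc i) \<notin> {p i, p (Suc i)} \<and> 3 - p i - p (Suc i) < 3"
    if "Suc i < k" for i
  proof -
    have "p i < 3" "p (Suc i) < 3" "p i \<noteq> p (Suc i)" using that p p_Suc by auto
    then show ?thesis unfolding insert_iff empty_iff by arith
  qed
  show "subgraph H G" by fact
  fix i assume i: "i < k"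
  have lt: "Suc i < k" if "i \<noteq> k - 1" using i that by auto
  have sc: "sgn_of G (c i) \<in> {1, -1}" and sa: "sgn_of G (a i) \<in> {1, -1}"
    and sb: "sgn_of G (b i) \<in> {1, -1}" and t: "prefix_sign i \<in> {1, -1}"
    using i sgn_cases edge_mem prefix_sign_cases by auto
  have t_Suc: "prefix_sign (Suc i) = prefix_sign i * sgn_of G (c i)"
    by (simp add: prefix_sign_def)
  show "p i < 3" "prefix_sign i \<in> {1, -1}" using i p t by auto
  show "(if i = k - 1 then q else 3 - p i - p (Suc i)) < 3"
    using q third lt by auto
  show "(if i = k - 1 then r else prefix_sign i * sgn_of G (a i)) \<in> {1, -1}"
    using r sa t by auto
  show "sgn_of G (c i) =
      prefix_sign i * prefix_sign (Suc i mod k) * mono_sign (p i) (p (Suc i mod k))"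
    if "c i \<in> edges H"
  proof (cases "i = k - 1")
    case True
    then show ?thesis
      using that c prefix_sign_last prefix_sign_0 sc t last by auto
  next
    case False
    then show ?thesis using lt p_Suc t sc t_Suc by auto
  qed
  show "sgn_of G (a i) =
      (if i = k - 1 then r else prefix_sign i * sgn_of G (a i)) * prefix_sign i *
      mono_sign (if i = k - 1 then q else 3 - p i - p (Suc i)) (p i)"
    if "a i \<in> edges H"
  proof (cases "i = k - 1")
    case True
    then show ?thesis using that a by simp
  next
    case False
    then have "mono_sign (3 - p i - p (Suc i)) (p i) = 1" using third lt by simp
    then show ?thesis using t False by auto
  qed
  show "sgn_of G (b i) =
      (if i = k - 1 then r else prefix_sign i * sgn_of G (a i)) * prefix_sign (Suc i mod k) *
      mono_sign (if i = k - 1 then q else 3 - p i - p (Suc i)) (p (Suc i mod k))"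
    if "b i \<in> edges H"
  proof (cases "i = k - 1")
    case True
    then show ?thesis using that b last prefix_sign_0 by simp
  next
    case False
    then have "mono_sign (3 - p i - p (Suc i)) (p (Suc i)) = 1" using third lt by simp
    \<comment> \<open>The square of \<open>prefix_sign i\<close> cancels and leaves the product of
      the signs of \<open>a i\<close> and \<open>c i\<close>, which is the sign of
      \<open>b i\<close> in a positive triangle.\<close>
    then show ?thesis using t False lt triangle_sign[OF i] sc sa sb t_Suc by auto
  qed
qed

text \<open>Without \<open>c (k - 1)\<close>, the edge \<open>a (k - 1)\<close> is made
  monochromatic; without \<open>a (k - 1)\<close> or \<open>b (k - 1)\<close>, it is
  \<open>c (k - 1)\<close>, and the switch at the new vertex is chosen to suit the other edge
  there.\<close>

lemma hom_to_C3_star_if_last_triangle_broken: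
  assumes H: "subgraph H G" and e: "e \<in> {c (k - 1), a (k - 1), b (k - 1)}" "e \<notin> edges H"
  shows "hom_to H C3_star"
proof -
  let ?m = "k - 1"
  let ?t = "prefix_sign ?m"
  have m: "?m < k" and m1: "?m \<noteq> 0" using k by auto
  have sgn: "sgn_of G (c ?m) \<in> {1, -1}" "sgn_of G (a ?m) \<in> {1, -1}" "sgn_of G (b ?m) \<in> {1, -1}"
    "?t \<in> {1, -1}"
    using m sgn_cases edge_mem prefix_sign_cases by auto
  \<comment> \<open>\<open>open_col\<close> runs 0, 2, 1, 2, 1, ..., so colour 0 occurs only at the
    start. \<open>closed_col\<close> repeats it at the last vertex to make the closing edge
    monochromatic.\<close>
  define open_col :: "nat \<Rightarrow> nat" where "open_col i = (if i = 0 then 0 else 1 + i mod 2)" for i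
  define closed_col :: "nat \<Rightarrow> nat" where "closed_col i = (if i = ?m then 0 else open_col i)" for i
  have open_lt: "open_col i < 3" and open_Suc: "open_col i \<noteq> open_col (Suc i)" for i
    by (auto simp: open_col_def mod_Suc)
  have closed_lt: "closed_col i < 3" for i
    by (simp add: closed_col_def open_lt)
  \<comment> \<open>Since \<open>k \<ge> 3\<close>, the index before the last is not 0, so its
    colour is not 0.\<close>
  have closed_Suc: "closed_col i \<noteq> closed_col (Suc i)" if "Suc i < k" for i
    using that open_Suc[of i] k by (auto simp: closed_col_def open_col_def)
  have closed_ends: "closed_col ?m = 0" "closed_col 0 = 0"
    by (auto simp: closed_col_def open_col_def)
  from e(1) consider "e = c ?m" | "e = a ?m" | "e = b ?m" by auto
  then show ?thesis
  proof cases
    case 1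
    show ?thesis
    proof (rule hom_to_C3_star_last_triangleI[where p = open_col and q = "open_col ?m"
          and r = "- ?t * sgn_of G (a ?m)", OF H open_lt open_Suc open_lt])
      \<comment> \<open>By \<open>prefix_sign_last\<close> the missing cycle edge has sign
        \<open>- ?t\<close>, and the positive triangle in \<open>G\<close> ties the sign of
        \<open>b ?m\<close> to those of \<open>c ?m\<close> and \<open>a ?m\<close>.\<close>
      show "sgn_of G (b ?m) = - ?t * sgn_of G (a ?m) * mono_sign (open_col ?m) (open_col 0)"
        using sgn triangle_sign[OF m] prefix_sign_last m1 by (auto simp: open_col_def)
    qed (use 1 e sgn in auto)
  next
    case 2
    show ?thesis
      by (rule hom_to_C3_star_last_triangleI[where p = closed_col and q = 1
          and r = "sgn_of G (b ?m)", OF H closed_lt closed_Suc])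
        (use 2 e sgn closed_ends in auto)
  next
    case 3
    show ?thesis
      by (rule hom_to_C3_star_last_triangleI[where p = closed_col and q = 1
          and r = "?t * sgn_of G (a ?m)", OF H closed_lt closed_Suc])
        (use 3 e sgn closed_ends in auto)
  qed
qed

section \<open>Rotation and criticality\<close>

text \<open>The cyclic symmetry of the definition makes every triangle the last one in some
  labelling, so that one construction treats all missing edges.\<close>

lemma S_hat_rotate:
  defines "\<rho> d i \<equiv> (i + d) mod k"
  shows "S_hat k G (x \<circ> \<rho> d) (s \<circ> \<rho> d) (c \<circ> \<rho> d) (a \<circ> \<rho> d) (b \<circ> \<rho> d)"
proof -
  have lt: "\<rho> d i < k" for i using k by (simp add: \<rho>_def)
  have "inj_on (\<rho> d) {..<k}"
  proof (rule inj_onI)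
    fix i j assume ij: "i \<in> {..<k}" "j \<in> {..<k}" "\<rho> d i = \<rho> d j"
    then have "int (i + d) mod int k = int (j + d) mod int k"
      unfolding \<rho>_def by (metis zmod_int)
    then have "int i mod int k = int j mod int k"
      by (metis add_diff_cancel_right' mod_diff_left_eq of_nat_add)
    then show "i = j" using ij by simp
  qed
  moreover from this have img: "\<rho> d ` {..<k} = {..<k}"
    using lt by (intro endo_inj_surj) auto
  ultimately have bij: "bij_betw (\<rho> d) {..<k} {..<k}" by (simp add: bij_betw_def)
  have inj: "inj_on (g \<circ> \<rho> d) {..<k}" if "inj_on g {..<k}" for g :: "nat \<Rightarrow> 'z"
    using that bij by (auto simp: bij_betw_def intro: comp_inj_on)
  have image: "(g \<circ> \<rho> d) ` {..<k} = g ` {..<k}" for g :: "nat \<Rightarrow> 'z"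
    by (simp only: image_comp[symmetric] img)
  \<comment> \<open>Commuting with the cyclic successor is what carries the end conditions
    over.\<close>
  have Suc: "\<rho> d (Suc i mod k) = Suc (\<rho> d i) mod k" for i
    by (simp add: \<rho>_def mod_simps)
  have "(\<Prod>i<k. sgn_of G ((c \<circ> \<rho> d) i)) = -1"
    using prod.reindex_bij_betw[OF bij, of "\<lambda>i. sgn_of G (c i)"] cycle_sign by simp
  then show ?thesis
    unfolding S_hat_def image
    using k G inj_x inj_s x_s verts_eq inj_c inj_a inj_b c_a c_b a_b edges_eq
    by (auto simp: inj ends_c ends_a ends_b triangle_sign lt Suc)
qed

text \<open>Every vertex is an end of some \<open>a i\<close>, so a proper subgraph lacks an edge; a
  rotation puts the triangle of that edge last.\<close>

lemma critical: "C3_star_critical G"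
  unfolding C3_star_critical_def
proof (intro conjI allI impI)
  fix H assume "proper_subgraph H G"
  then have H: "subgraph H G" and ne: "verts H \<noteq> verts G \<or> edges H \<noteq> edges G"
    by (auto simp: proper_subgraph_def)
  have "verts H = verts G" if "edges H = edges G"
  proof -
    have "v \<in> verts H" if v: "v \<in> verts G" for v
    proof -
      obtain i where "i < k" "v \<in> ends G (a i)"
        using v by (auto simp: verts_eq ends_a)
      then show ?thesis
        using H \<open>edges H = edges G\<close> edge_mem(2) by (fastforce simp: subgraph_def signed_graph_def)
    qed
    then show ?thesis using H by (auto simp: subgraph_def)
  qed
  then obtain e where e: "e \<in> edges G" "e \<notin> edges H"
    using H ne by (auto simp: subgraph_def)
  from e(1) obtain j where j: "j < k" "e \<in> {c j, a j, b j}"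
    by (cases rule: edge_cases) auto
  \<comment> \<open>The shift by \<open>Suc j\<close> sends the last index \<open>k - 1\<close> to
    \<open>j\<close>.\<close>
  interpret R: S_hat k G "x \<circ> (\<lambda>i. (i + Suc j) mod k)" "s \<circ> (\<lambda>i. (i + Suc j) mod k)"
    "c \<circ> (\<lambda>i. (i + Suc j) mod k)" "a \<circ> (\<lambda>i. (i + Suc j) mod k)" "b \<circ> (\<lambda>i. (i + Suc j) mod k)"
    by (rule S_hat_rotate)
  have "(k - 1 + Suc j) mod k = j" using j k by simp
  then show "hom_to H C3_star"
    using R.hom_to_C3_star_if_last_triangle_broken[OF H, of e] j e by simp
qed (use G no_digon no_loop not_hom_to_C3_star in \<open>auto simp: has_positive_loop_def\<close>)

end

section \<open>An infinite family of pairwise inequivalent examples\<close>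

text \<open>Vertices below \<open>k\<close> form the cycle and \<open>k + i\<close> is the apex of
  triangle \<open>i\<close>; edges \<open>i\<close>, \<open>k + i\<close>, \<open>2 * k + i\<close>
  serve as \<open>c i\<close>, \<open>a i\<close>, \<open>b i\<close>. The negative edges are
  \<open>c 0\<close> and \<open>a 0\<close>: the cycle becomes negative and triangle 0 stays
  positive.\<close>

definition S_hat_graph :: "nat \<Rightarrow> (nat, nat) sgraph" where
  "S_hat_graph k = \<lparr> verts = {..<2 * k}, edges = {..<3 * k},
     ends = (\<lambda>e. if e < k then {e, Suc e mod k} else if e < 2 * k then {e, e - k}
        else {e - k, Suc (e - 2 * k) mod k}),
     sgn_of = (\<lambda>e. if e = 0 \<or> e = k then -1 else 1) \<rparr>"

lemma S_hat_S_hat_graph: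
  assumes k: "k \<ge> 3"
  shows "S_hat k (S_hat_graph k) (\<lambda>i. i) (\<lambda>i. k + i) (\<lambda>i. i) (\<lambda>i. k + i) (\<lambda>i. 2 * k + i)"
proof -
  have shift: "(\<lambda>i. d + i) ` {..<k} = {d..<d + k}" for d
    using image_add_atLeastLessThan[of d 0 k] by (simp only: lessThan_atLeast0 add_0 add.commute[of k d])
  have "(\<Prod>i<k. sgn_of (S_hat_graph k) i) = (\<Prod>i<k. if i = 0 then -1 else 1)"
    by (rule prod.cong) (auto simp: S_hat_graph_def)
  also have "\<dots> = -1" using k by simp
  finally have "(\<Prod>i<k. sgn_of (S_hat_graph k) i) = -1" .
  moreover have "signed_graph (S_hat_graph k)"
  proof -
    have "Suc e mod k < 2 * k" "Suc e mod k < k" for e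
      using k by (auto intro: less_le_trans[OF mod_less_divisor])
    then show ?thesis
      using k by (auto simp: signed_graph_def S_hat_graph_def card_insert_if)
  qed
  ultimately show ?thesis
    unfolding S_hat_def shift using k by (auto simp: S_hat_graph_def)
qed

lemma switching_equivalent_verts:
  "switching_equivalent G H \<Longrightarrow> verts H = verts G"
  unfolding switching_equivalent_def
  by (induction rule: rtranclp_induct) (auto simp: switch_at_def)

text \<open>Switching alters only signs, and isomorphisms are bijective on vertices. This invariant
  is enough to tell the members of the family apart.\<close>

lemma switching_isomorphic_card_verts:
  "switching_isomorphic G H \<Longrightarrow> card (verts G) = card (verts H)"
  unfolding switching_isomorphic_def isomorphic_def
  by (metis bij_betw_same_card switching_equivalent_verts)

theorem mainTheorem4:
  shows "(\<forall>k::nat. k \<ge> 3 \<longrightarrow>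
            (\<exists>G :: (nat, nat) sgraph. is_S_hat k G) \<and>
            (\<forall>G :: ('v, 'e) sgraph. is_S_hat k G \<longrightarrow>
               C3_star_critical G \<and>
               real (card (edges G)) = 3 * real (card (verts G)) / 2))
       \<and> (\<exists>F :: (nat, nat) sgraph set. infinite F \<and>
            (\<forall>G\<in>F. C3_star_critical G \<and>
               real (card (edges G)) = 3 / 2 * real (card (verts G))) \<and>
            pairwise (\<lambda>G H. \<not> switching_isomorphic G H) F)"
proof (intro conjI allI impI)
  fix k :: nat assume k: "k \<ge> 3"
  show "\<exists>G :: (nat, nat) sgraph. is_S_hat k G"
    using S_hat_S_hat_graph[OF k] is_S_hat_iff[OF k] by blast
  fix G :: "('v, 'e) sgraph" assume "is_S_hat k G"
  then obtain x s c a b where "S_hat k G x s c a b"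
    using is_S_hat_iff[OF k] by blast
  then interpret S_hat k G x s c a b .
  show "C3_star_critical G" by (rule critical)
  show "real (card (edges G)) = 3 * real (card (verts G)) / 2"
    by (simp add: card_edges card_verts)
next
  note S = S_hat_S_hat_graph
  have card: "card (verts (S_hat_graph k)) = 2 * k" if "k \<ge> 3" for k
    using S_hat.card_verts[OF S[OF that]] .
  have "inj_on S_hat_graph {3..}"
    by (rule inj_onI) (metis card atLeast_iff mult_left_cancel zero_neq_numeral)
  then have "infinite (S_hat_graph ` {3..})"
    using finite_imageD infinite_Ici by blast
  moreover have "C3_star_critical (S_hat_graph k) \<and>
      real (card (edges (S_hat_graph k))) = 3 / 2 * real (card (verts (S_hat_graph k)))"
    if "k \<ge> 3" for k
    using S_hat.critical[OF S[OF that]] S_hat.card_edges[OF S[OF that]] card[OF that] by simp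
  moreover have "pairwise (\<lambda>G H. \<not> switching_isomorphic G H) (S_hat_graph ` {3..})"
    using switching_isomorphic_card_verts card by (fastforce simp: pairwise_def)
  ultimately show "\<exists>F :: (nat, nat) sgraph set. infinite F \<and>
            (\<forall>G\<in>F. C3_star_critical G \<and>
               real (card (edges G)) = 3 / 2 * real (card (verts G))) \<and>
            pairwise (\<lambda>G H. \<not> switching_isomorphic G H) F"
    by (intro exI[of _ "S_hat_graph ` {3..}"]) auto
qed

end
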